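(* Let $\mathfrak A$ be a generalized model in the narrow sense with universe $\beta X$ and interpretation $\imath$. Then $\lim I(\mathfrak A)=E(\mathfrak A)$; that is, for each functional symbol $F$ and predicate symbol $R$, the ultrafilters $I(\imath(F))$ and $I(\imath(R))$ have limits $E(\imath(F))$ and $E(\imath(R))$, respectively.
   Context: $\beta X$ is the set of ultrafilters on $X$, $X\subseteq\beta X$ via principal ultrafilters, standard compact Hausdorff topology; $(\forall^{\mathfrak u}x)\varphi$ means $\{x:\varphi\}\in\mathfrak u$; $(\beta X)^n$ carries the product topology. For $f:X^n\to X$, $\tilde f(\mathfrak u_1,\dots,\mathfrak u_n)=\{A:(\forall^{\mathfrak u_1}x_1)\cdots(\forall^{\mathfrak u_n}x_n)f(x_1,\dots,x_n)\in A\}$; for $Q\subseteq X^n$, $\tilde Q=\{(\mathfrak u_i):(\forall^{\mathfrak u_1}x_1)\cdots(\forall^{\mathfrak u_n}x_n)(x_1,\dots,x_n)\in Q\}$ and $Q^*=\{(\mathfrak u_i):\forall A_i\in\mathfrak u_i\ Q\cap(A_1\times\dots\times A_n)\neq\emptyset\}$. A generalized model in the narrow sense with universe $\beta X$ is an interpretation $\imath$ with $\imath(F)\in\beta(X^{X^n})$, $\imath(R)\in\beta\,\mathcal P(X^n)$. $\mathrm{RC}_n$: maps $(\beta X)^n\to\beta X$ right continuous w.r.t. $X$ (continuous in the $i$-th argument whenever the first $i-1$ arguments lie in $X$), with the topology of pointwise convergence on $X^n$ (compact Hausdorff). $\mathrm{RegCl}_n=\{Q^*:Q\subseteq X^n\}$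 (the regular closed subsets of $(\beta X)^n$) with the topology transported from the product space $\{0,1\}^{X^n}\cong\mathcal P(X^n)$ via the bijection $Q\mapsto Q^*$. $E=e$ on $\beta(X^{X^n})$ is the unique continuous extension of $f\mapsto\tilde f$ into $\mathrm{RC}_n$. On $\mathfrak r\in\beta\,\mathcal P(X^n)$: let $e_1(\mathfrak r)\subseteq\beta(X^n)$ be the value at $\mathfrak r$ of the unique continuous extension of $Q\mapsto\{\mathfrak q\in\beta(X^n):Q\in\mathfrak q\}$ (clopen subsets of $\beta(X^n)$ identified with continuous maps into discrete $\{0,1\}$, topologized by pointwise convergence on $X^n$), and $E(\mathfrak r)=\{(\pi_1(\mathfrak q),\dots,\pi_n(\mathfrak q)):\mathfrak q\in e_1(\mathfrak r)\}$ with $\pi_j(\mathfrak q)=\{A:\{x:x_j\in A\}\in\mathfrak q\}$. $E(\mathfrak A)=(\beta X,E(\imath(F)),\dots,E(\imath(R)),\dots)$. $I(\mathfrak f)=\{B:\{f:\tilde f\in B\}\in\mathfrak f\}$ for $\mathfrak f\in\beta(X^{X^n})$ (concentrated on $\mathrm{RC}_n$), and $I(\mathfrak r)=\{B\subseteq\mathcal P((\beta X)^n):\{Q:Q^*\in B\}\in\mathfrak r\}$ for $\mathfrak r\in\beta\,\mathcal P(X^n)$ (concentrated on $\mathrm{RegCl}_n$); $I(\mathfrak A)$ interprets each symbol by $I$ of its $\imath$-interpretation. Limits are taken in $\mathrm{RC}_n$, resp. $\mathrm{RegCl}_n$ (a limit is the unique point of convergence), and $\lim I(\mathfrak A)$ is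 the ordinary model on $\beta X$ interpreting each symbol by the limit. *)

theory Defs
  imports "HOL-Analysis.Analysis"
begin

(* Ultrafilters on a set S are proper maximal library filters F with F <= principal S;
   "A belongs to F" is rendered as "eventually (%x. x : A) F", the quantifier over an
   ultrafilter as "eventually", and the principal ultrafilter at x as "principal {x}". *)

definition ultrafilter :: "'a filter \<Rightarrow> bool" where
  "ultrafilter F \<longleftrightarrow>
     F \<noteq> bot \<and> (\<forall>P. eventually P F \<or> eventually (\<lambda>x. \<not> P x) F)"

definition beta :: "'a set \<Rightarrow> 'a filter set" where
  "beta S = {u. ultrafilter u \<and> u \<le> principal S}"

definition beta_top :: "'a set \<Rightarrow> 'a filter topology" where
  "beta_top S =
     topology_generated_by {{u \<in> beta S. \<forall>\<^sub>F x in u. x \<in> A} | A. A \<subseteq> S}"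

(* The n-th power of S; arguments are indexed by 0, ..., n - 1. *)
definition tuples :: "nat \<Rightarrow> 'a set \<Rightarrow> (nat \<Rightarrow> 'a) set" where
  "tuples n S = ({..<n} \<rightarrow>\<^sub>E S)"

definition principal_tuple :: "nat \<Rightarrow> (nat \<Rightarrow> 'a) \<Rightarrow> nat \<Rightarrow> 'a filter" where
  "principal_tuple n x = (\<lambda>i\<in>{..<n}. principal {x i})"

definition operations :: "nat \<Rightarrow> 'a set \<Rightarrow> ((nat \<Rightarrow> 'a) \<Rightarrow> 'a) set" where
  "operations n S = (tuples n S \<rightarrow>\<^sub>E S)"

(* The quantifier over u 0 is outermost and the one over u (n - 1) is innermost. *)
fun iterated :: "nat \<Rightarrow> (nat \<Rightarrow> 'a filter) \<Rightarrow> ((nat \<Rightarrow> 'a) \<Rightarrow> bool) \<Rightarrow> bool" where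
  "iterated 0 u P = P (\<lambda>_. undefined)"
| "iterated (Suc n) u P = iterated n u (\<lambda>x. \<forall>\<^sub>F a in u n. P (x(n := a)))"

definition tilde ::
  "nat \<Rightarrow> 'a set \<Rightarrow> ((nat \<Rightarrow> 'a) \<Rightarrow> 'a) \<Rightarrow> (nat \<Rightarrow> 'a filter) \<Rightarrow> 'a filter" where
  "tilde n X f =
     (\<lambda>u\<in>tuples n (beta X). Abs_filter (\<lambda>P. iterated n u (\<lambda>x. P (f x))))"

definition star ::
  "nat \<Rightarrow> 'a set \<Rightarrow> (nat \<Rightarrow> 'a) set \<Rightarrow> (nat \<Rightarrow> 'a filter) set" where
  "star n X Q =
     {u \<in> tuples n (beta X).
        \<forall>A. (\<forall>i<n. A i \<subseteq> X \<and> (\<forall>\<^sub>F x in u i. x \<in> A i)) \<longrightarrow>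
          Q \<inter> Pi\<^sub>E {..<n} A \<noteq> {}}"

definition RC :: "nat \<Rightarrow> 'a set \<Rightarrow> ((nat \<Rightarrow> 'a filter) \<Rightarrow> 'a filter) set" where
  "RC n X =
     {g \<in> tuples n (beta X) \<rightarrow>\<^sub>E beta X.
        \<forall>i<n. \<forall>u\<in>tuples n (beta X). (\<forall>j<i. \<exists>x\<in>X. u j = principal {x}) \<longrightarrow>
          continuous_map (beta_top X) (beta_top X) (\<lambda>v. g (u(i := v)))}"

(* Pointwise convergence at the tuples of principal ultrafilters only. *)
definition RC_top ::
  "nat \<Rightarrow> 'a set \<Rightarrow> ((nat \<Rightarrow> 'a filter) \<Rightarrow> 'a filter) topology" where
  "RC_top n X =
     pullback_topology (RC n X) (\<lambda>g. \<lambda>x\<in>tuples n X. g (principal_tuple n x))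
       (product_topology (\<lambda>_. beta_top X) (tuples n X))"

(* The power set of S as the product of copies of the discrete two-point space. *)
definition Pow_top :: "'a set \<Rightarrow> 'a set topology" where
  "Pow_top S =
     pullback_topology (Pow S) (\<lambda>Q. \<lambda>x\<in>S. x \<in> Q)
       (product_topology (\<lambda>_. discrete_topology (UNIV :: bool set)) S)"

definition RegCl :: "nat \<Rightarrow> 'a set \<Rightarrow> (nat \<Rightarrow> 'a filter) set set" where
  "RegCl n X = star n X ` Pow (tuples n X)"

definition RegCl_top :: "nat \<Rightarrow> 'a set \<Rightarrow> (nat \<Rightarrow> 'a filter) set topology" where
  "RegCl_top n X =
     pullback_topology (RegCl n X) (inv_into (Pow (tuples n X)) (star n X))
       (Pow_top (tuples n X))"

definition continuous_extension ::
  "'a set \<Rightarrow> 'b topology \<Rightarrow> ('a \<Rightarrow> 'b) \<Rightarrow> 'a filter \<Rightarrow> 'b" where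
  "continuous_extension S T h =
     (THE g. g \<in> extensional (beta S) \<and> continuous_map (beta_top S) T g \<and>
        (\<forall>x\<in>S. g (principal {x}) = h x))"

definition clopens :: "'a set \<Rightarrow> 'a filter set set" where
  "clopens S = {C. openin (beta_top S) C \<and> closedin (beta_top S) C}"

(* A clopen set is identified with its characteristic function, and convergence is
   pointwise at the principal ultrafilters. *)
definition clopens_top :: "'a set \<Rightarrow> 'a filter set topology" where
  "clopens_top S =
     pullback_topology (clopens S) (\<lambda>C. \<lambda>x\<in>S. principal {x} \<in> C)
       (product_topology (\<lambda>_. discrete_topology (UNIV :: bool set)) S)"

definition E_fun ::
  "nat \<Rightarrow> 'a set \<Rightarrow> ((nat \<Rightarrow> 'a) \<Rightarrow> 'a) filter \<Rightarrow> (nat \<Rightarrow> 'a filter) \<Rightarrow> 'a filter" where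
  "E_fun n X = continuous_extension (operations n X) (RC_top n X) (tilde n X)"

definition e1 ::
  "nat \<Rightarrow> 'a set \<Rightarrow> (nat \<Rightarrow> 'a) set filter \<Rightarrow> (nat \<Rightarrow> 'a) filter set" where
  "e1 n X =
     continuous_extension (Pow (tuples n X)) (clopens_top (tuples n X))
       (\<lambda>Q. {q \<in> beta (tuples n X). \<forall>\<^sub>F x in q. x \<in> Q})"

definition E_pred ::
  "nat \<Rightarrow> 'a set \<Rightarrow> (nat \<Rightarrow> 'a) set filter \<Rightarrow> (nat \<Rightarrow> 'a filter) set" where
  "E_pred n X r = (\<lambda>q. \<lambda>j\<in>{..<n}. filtermap (\<lambda>x. x j) q) ` e1 n X r"

definition I_fun ::
  "nat \<Rightarrow> 'a set \<Rightarrow> ((nat \<Rightarrow> 'a) \<Rightarrow> 'a) filter \<Rightarrow>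
     ((nat \<Rightarrow> 'a filter) \<Rightarrow> 'a filter) filter" where
  "I_fun n X f = filtermap (tilde n X) f"

definition I_pred ::
  "nat \<Rightarrow> 'a set \<Rightarrow> (nat \<Rightarrow> 'a) set filter \<Rightarrow> (nat \<Rightarrow> 'a filter) set filter" where
  "I_pred n X r = filtermap (star n X) r"

definition is_limit :: "'a topology \<Rightarrow> 'a filter \<Rightarrow> 'a \<Rightarrow> bool" where
  "is_limit T D l \<longleftrightarrow>
     limitin T (\<lambda>x. x) l D \<and> (\<forall>l'. limitin T (\<lambda>x. x) l' D \<longrightarrow> l' = l)"

definition the_limit :: "'a topology \<Rightarrow> 'a filter \<Rightarrow> 'a" where
  "the_limit T D = (THE l. is_limit T D l)"

record ('f, 'p) signature =
  fun_syms :: "'f set"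
  pred_syms :: "'p set"
  fun_arity :: "'f \<Rightarrow> nat"
  pred_arity :: "'p \<Rightarrow> nat"

(* 'v and 'w are the types of the values interpreting functional and predicate symbols:
   operations and relations on the universe for ordinary models, ultrafilters over
   those for generalized models. *)
record ('u, 'f, 'v, 'p, 'w) model =
  universe :: "'u set"
  fun_int :: "'f \<Rightarrow> 'v"
  pred_int :: "'p \<Rightarrow> 'w"

definition narrow_model ::
  "('f, 'p) signature \<Rightarrow> 'a set \<Rightarrow>
     ('a filter, 'f, ((nat \<Rightarrow> 'a) \<Rightarrow> 'a) filter, 'p, (nat \<Rightarrow> 'a) set filter) model \<Rightarrow> bool"
where
  "narrow_model \<Sigma> X \<AA> \<longleftrightarrow>
     universe \<AA> = beta X \<and>
     (\<forall>F\<in>fun_syms \<Sigma>. fun_int \<AA> F \<in> beta (operations (fun_arity \<Sigma> F) X)) \<and>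
     (\<forall>R\<in>pred_syms \<Sigma>. pred_int \<AA> R \<in> beta (Pow (tuples (pred_arity \<Sigma> R) X)))"

definition E_model ::
  "('f, 'p) signature \<Rightarrow> 'a set \<Rightarrow>
     ('a filter, 'f, ((nat \<Rightarrow> 'a) \<Rightarrow> 'a) filter, 'p, (nat \<Rightarrow> 'a) set filter) model \<Rightarrow>
     ('a filter, 'f, (nat \<Rightarrow> 'a filter) \<Rightarrow> 'a filter, 'p, (nat \<Rightarrow> 'a filter) set) model"
where
  "E_model \<Sigma> X \<AA> =
     \<lparr> universe = beta X,
       fun_int = (\<lambda>F\<in>fun_syms \<Sigma>. E_fun (fun_arity \<Sigma> F) X (fun_int \<AA> F)),
       pred_int = (\<lambda>R\<in>pred_syms \<Sigma>. E_pred (pred_arity \<Sigma> R) X (pred_int \<AA> R)) \<rparr>"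

definition I_model ::
  "('f, 'p) signature \<Rightarrow> 'a set \<Rightarrow>
     ('a filter, 'f, ((nat \<Rightarrow> 'a) \<Rightarrow> 'a) filter, 'p, (nat \<Rightarrow> 'a) set filter) model \<Rightarrow>
     ('a filter, 'f, ((nat \<Rightarrow> 'a filter) \<Rightarrow> 'a filter) filter,
      'p, (nat \<Rightarrow> 'a filter) set filter) model"
where
  "I_model \<Sigma> X \<AA> =
     \<lparr> universe = beta X,
       fun_int = (\<lambda>F\<in>fun_syms \<Sigma>. I_fun (fun_arity \<Sigma> F) X (fun_int \<AA> F)),
       pred_int = (\<lambda>R\<in>pred_syms \<Sigma>. I_pred (pred_arity \<Sigma> R) X (pred_int \<AA> R)) \<rparr>"

definition lim_model ::
  "('f, 'p) signature \<Rightarrow> 'a set \<Rightarrow>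
     ('a filter, 'f, ((nat \<Rightarrow> 'a filter) \<Rightarrow> 'a filter) filter,
      'p, (nat \<Rightarrow> 'a filter) set filter) model \<Rightarrow>
     ('a filter, 'f, (nat \<Rightarrow> 'a filter) \<Rightarrow> 'a filter, 'p, (nat \<Rightarrow> 'a filter) set) model"
where
  "lim_model \<Sigma> X \<BB> =
     \<lparr> universe = beta X,
       fun_int = (\<lambda>F\<in>fun_syms \<Sigma>. the_limit (RC_top (fun_arity \<Sigma> F) X) (fun_int \<BB> F)),
       pred_int = (\<lambda>R\<in>pred_syms \<Sigma>. the_limit (RegCl_top (pred_arity \<Sigma> R) X) (pred_int \<BB> R)) \<rparr>"

end

theory Submission
  imports Defs
begin

(* Along an ultrafilter u on S the principal ultrafilters converge to u itself.  Hence the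
   continuous extension of h into a Hausdorff space takes at u the limit of h along u, which
   is the limit of the image of u under h; everything reduces to exhibiting the extensions.
   For operations the extension maps an ultrafilter of operations to the iterated limit of its
   pointwise limits.  For predicates let A be the set of points that belong to almost all Q:
   then e1 gives the clopen set of A, and by the ultrafilter lemma its image under the
   projections is the star of A. *)

section \<open>Ultrafilters\<close>

lemma ultrafilter_not:
  assumes "ultrafilter u"
  shows "eventually (\<lambda>x. \<not> P x) u \<longleftrightarrow> \<not> eventually P u"
proof -
  have "False" if "eventually P u" "eventually (\<lambda>x. \<not> P x) u"
    using eventually_conj[OF that] assms by (simp add: ultrafilter_def trivial_limit_def)
  then show ?thesis using assms unfolding ultrafilter_def by blast
qed

lemma ultrafilter_principal: "ultrafilter (principal {x})"
  by (auto simp: ultrafilter_def eventually_principal principal_eq_bot_iff)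

lemma ultrafilter_filtermap:
  "ultrafilter u \<Longrightarrow> ultrafilter (filtermap f u)"
  by (auto simp: ultrafilter_def eventually_filtermap filtermap_bot_iff)

text \<open>In the library order a smaller filter has more members, so ultrafilters are the minimal
  proper filters: a member of \<open>v\<close> missing from \<open>u\<close> would have its
  complement in \<open>u\<close>, hence in \<open>v\<close>.\<close>

lemma ultrafilter_eqI:
  assumes "ultrafilter u" "v \<noteq> bot" "v \<le> u"
  shows "v = u"
proof (rule antisym[OF assms(3)])
  show "u \<le> v"
    unfolding le_filter_def
  proof (intro allI impI)
    fix P assume "eventually P v"
    show "eventually P u"
    proof (rule ccontr)
      assume "\<not> eventually P u"
      then have "eventually (\<lambda>x. \<not> P x) v"
        using ultrafilter_not[OF assms(1)] filter_leD[OF assms(3)] by blast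
      from eventually_conj[OF \<open>eventually P v\<close> this] show False
        using assms(2) by (simp add: trivial_limit_def)
    qed
  qed
qed

text \<open>The ultrafilter lemma by Zorn: a minimal proper filter below \<open>F\<close> decides
  every predicate.\<close>

lemma ultrafilter_exists:
  fixes F :: "'a filter"
  assumes "F \<noteq> bot"
  obtains u where "ultrafilter u" "u \<le> F"
proof -
  let ?A = "{G. G \<noteq> bot \<and> G \<le> F}"
  \<comment> \<open>The order is reversed, so that the maximal elements supplied by Zorn are minimal
    proper filters.\<close>
  let ?r = "relation_of (\<lambda>G H. H \<le> G) ?A"
  have "partial_order_on ?A ?r"
    by (rule partial_order_on_relation_ofI) auto
  moreover have fld: "Field ?r = ?A"
    by (auto simp: Field_def relation_of_def)
  ultimately have po: "Partial_order ?r"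
    by simp
  have "\<exists>m\<in>Field ?r. \<forall>a\<in>Field ?r. (m, a) \<in> ?r \<longrightarrow> a = m"
  proof (rule Zorns_po_lemma[OF po])
    fix C assume C: "C \<in> Chains ?r"
    show "\<exists>m\<in>Field ?r. \<forall>a\<in>C. (a, m) \<in> ?r"
    proof (cases "C = {}")
      case True
      then show ?thesis using assms fld by auto
    next
      case False
      have sub: "C \<subseteq> ?A" 
        using C by (auto simp: Chains_def relation_of_def)
      have lin: "G \<le> H \<or> H \<le> G" if "G \<in> C" "H \<in> C" for G H
        using C that by (auto simp: Chains_def relation_of_def)
      \<comment> \<open>A chain is directed downwards, so whatever holds eventually in
        \<open>Inf C\<close> already does so in a member of \<open>C\<close>, and those are
        proper.\<close>
      have "Inf C \<noteq> bot"
      proof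
        assume "Inf C = bot"
        then have "eventually (\<lambda>_. False) (Inf C)" by simp
        moreover have "\<exists>K\<in>C. K \<le> inf G H" if "G \<in> C" "H \<in> C" for G H
          using lin[OF that]
        proof
          assume "G \<le> H"
          then show ?thesis using that by (intro bexI[of _ G]) simp_all
        next
          assume "H \<le> G"
          then show ?thesis using that by (intro bexI[of _ H]) simp_all
        qed
        ultimately obtain G where "G \<in> C" "eventually (\<lambda>_. False) G"
          using eventually_Inf_base[OF False] by blast
        then show False using sub by (auto simp: trivial_limit_def)
      qed
      moreover have "Inf C \<le> F"
        using False sub by (blast intro: Inf_lower2)
      ultimately have "Inf C \<in> ?A" by simp
      moreover from this have "\<forall>a\<in>C. (a, Inf C) \<in> ?r"
        using sub by (simp add: relation_of_def Inf_lower subset_iff)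
      ultimately show ?thesis unfolding fld by blast
    qed
  qed
  then obtain m where "m \<in> ?A" and max: "\<And>a. a \<in> ?A \<Longrightarrow> (m, a) \<in> ?r \<Longrightarrow> a = m"
    unfolding fld by blast
  then have m: "m \<noteq> bot" "m \<le> F" by simp_all
  have min: "a = m" if "a \<noteq> bot" "a \<le> m" for a
    using that m by (intro max) (simp_all add: relation_of_def order_trans[OF \<open>a \<le> m\<close>])
  have "eventually P m \<or> eventually (\<lambda>x. \<not> P x) m" for P
  proof (rule disjCI)
    \<comment> \<open>The trace of \<open>m\<close> on \<open>P\<close> is then a proper filter
      below \<open>m\<close>, hence \<open>m\<close> itself by minimality.\<close>
    assume "\<not> eventually (\<lambda>x. \<not> P x) m"
    then have "inf m (principal {x. P x}) \<noteq> bot"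
      by (simp add: trivial_limit_def eventually_inf_principal)
    then have "inf m (principal {x. P x}) = m"
      by (rule min) simp
    moreover have "eventually P (inf m (principal {x. P x}))"
      by (simp add: eventually_inf_principal)
    ultimately show "eventually P m" by simp
  qed
  then have "ultrafilter m" using m by (simp add: ultrafilter_def)
  with m that show ?thesis by blast
qed

lemma beta_ultrafilter: "u \<in> beta S \<Longrightarrow> ultrafilter u"
  by (simp add: beta_def)

lemma beta_eventually_mem: "u \<in> beta S \<Longrightarrow> eventually (\<lambda>x. x \<in> S) u"
  by (simp add: beta_def le_principal)

lemma eventually_beta_restrict:
  "u \<in> beta S \<Longrightarrow> eventually (\<lambda>x. x \<in> S \<and> P x) u \<longleftrightarrow> eventually P u"
  using beta_eventually_mem[of u S] by (auto simp: eventually_conj_iff)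

lemma principal_in_beta: "x \<in> S \<Longrightarrow> principal {x} \<in> beta S"
  by (simp add: beta_def ultrafilter_principal)

lemma filtermap_in_beta:
  assumes "u \<in> beta S" "\<And>x. x \<in> S \<Longrightarrow> f x \<in> T"
  shows "filtermap f u \<in> beta T"
  using assms eventually_mono[OF beta_eventually_mem[OF assms(1)], of "\<lambda>x. f x \<in> T"]
  by (simp add: beta_def ultrafilter_filtermap le_principal eventually_filtermap)

section \<open>The space of ultrafilters\<close>

lemma topspace_beta_top [simp]: "topspace (beta_top S) = beta S"
  unfolding beta_top_def topology_generated_by_topspace
  using beta_eventually_mem by blast

text \<open>The generating sets come from subsets of \<open>S\<close>, but any predicate may be
  used: an ultrafilter on \<open>S\<close> sees only its trace on \<open>S\<close>.\<close>

lemma openin_beta_top: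
  "openin (beta_top S) {u \<in> beta S. eventually P u}"
proof -
  have "{u \<in> beta S. eventually P u} = {u \<in> beta S. \<forall>\<^sub>F x in u. x \<in> {x \<in> S. P x}}"
    by (auto simp: eventually_beta_restrict)
  then show ?thesis
    unfolding beta_top_def by (intro topology_generated_by_Basis) blast
qed

lemma closedin_beta_top:
  "closedin (beta_top S) {u \<in> beta S. eventually P u}"
proof -
  have "beta S - {u \<in> beta S. eventually P u} = {u \<in> beta S. eventually (\<lambda>x. \<not> P x) u}"
    by (auto simp: ultrafilter_not[OF beta_ultrafilter[of _ S]])
  then show ?thesis
    by (simp add: closedin_def openin_beta_top)
qed

lemma continuous_map_into_beta_top:
  assumes "\<And>t. t \<in> topspace T \<Longrightarrow> f t \<in> beta S"
    and "\<And>A. A \<subseteq> S \<Longrightarrow> openin T {t \<in> topspace T. \<forall>\<^sub>F x in f t. x \<in> A}"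
  shows "continuous_map T (beta_top S) f"
  unfolding beta_top_def
proof (rule continuous_on_generated_topo)
  show "f ` topspace T \<subseteq> \<Union> {{u \<in> beta S. \<forall>\<^sub>F x in u. x \<in> A} |A. A \<subseteq> S}"
    using assms(1) beta_eventually_mem by blast
next
  fix U assume "U \<in> {{u \<in> beta S. \<forall>\<^sub>F x in u. x \<in> A} |A. A \<subseteq> S}"
  then obtain A where A: "A \<subseteq> S" "U = {u \<in> beta S. \<forall>\<^sub>F x in u. x \<in> A}" by blast
  then have "f -` U \<inter> topspace T = {t \<in> topspace T. \<forall>\<^sub>F x in f t. x \<in> A}"
    using assms(1) by auto
  then show "openin T (f -` U \<inter> topspace T)"
    using assms(2) A by simp
qed

lemma continuous_map_eventually:
  "continuous_map (beta_top S) (discrete_topology UNIV) (\<lambda>u. eventually P u)"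
proof -
  have "openin (beta_top S) {u \<in> beta S. eventually P u \<in> U}" for U
  proof -
    have "eventually P u \<in> U \<longleftrightarrow> eventually (\<lambda>x. P x \<in> U) u" if "u \<in> beta S" for u
    proof -
      \<comment> \<open>The four sets \<open>U\<close> of truth values turn
        \<open>P x \<in> U\<close> into a constant, \<open>P x\<close> or its negation, and the
        quantifier over an ultrafilter commutes with each of these.\<close>
      have "(\<lambda>x. P x \<in> U) = (if True \<in> U then (if False \<in> U then (\<lambda>_. True) else P)
          else (if False \<in> U then (\<lambda>x. \<not> P x) else (\<lambda>_. False)))"
      proof
        show "(P x \<in> U) = (if True \<in> U then (if False \<in> U then (\<lambda>_. True) else P)
          else (if False \<in> U then (\<lambda>x. \<not> P x) else (\<lambda>_. False))) x" for x
          by (cases "P x") simp_all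
      qed
      moreover have "u \<noteq> bot" "eventually (\<lambda>x. \<not> P x) u \<longleftrightarrow> \<not> eventually P u"
        using beta_ultrafilter[OF that] by (simp_all add: ultrafilter_not) (simp add: ultrafilter_def)
      ultimately show ?thesis
        by (cases "eventually P u") auto
    qed
    then have "{u \<in> beta S. eventually P u \<in> U} = {u \<in> beta S. eventually (\<lambda>x. P x \<in> U) u}"
      by blast
    then show ?thesis by (simp add: openin_beta_top)
  qed
  then show ?thesis by (simp add: continuous_map_def)
qed

lemma Hausdorff_space_beta_top: "Hausdorff_space (beta_top S)"
  unfolding Hausdorff_space_def topspace_beta_top
proof (intro allI impI)
  fix u v assume uv: "u \<in> beta S \<and> v \<in> beta S \<and> u \<noteq> v"
  \<comment> \<open>Distinct ultrafilters are incomparable by minimality, so some predicate tells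
    them apart and yields two disjoint open sets.\<close>
  then have "\<not> v \<le> u"
    using ultrafilter_eqI[of u v] beta_ultrafilter[of _ S] by (auto simp: ultrafilter_def)
  then obtain P where P: "eventually P u" "\<not> eventually P v"
    unfolding le_filter_def by blast
  have "openin (beta_top S) {w \<in> beta S. eventually P w}"
    "openin (beta_top S) {w \<in> beta S. eventually (\<lambda>x. \<not> P x) w}"
    by (rule openin_beta_top)+
  moreover have "disjnt {w \<in> beta S. eventually P w} {w \<in> beta S. eventually (\<lambda>x. \<not> P x) w}"
    by (auto simp: disjnt_iff ultrafilter_not[OF beta_ultrafilter[of _ S]])
  moreover have "u \<in> {w \<in> beta S. eventually P w}" "v \<in> {w \<in> beta S. eventually (\<lambda>x. \<not> P x) w}"
    using uv P by (auto simp: ultrafilter_not[OF beta_ultrafilter[of _ S]])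
  ultimately show "\<exists>U V. openin (beta_top S) U \<and> openin (beta_top S) V \<and> u \<in> U \<and> v \<in> V \<and> disjnt U V"
    by blast
qed

text \<open>A generating neighbourhood given by \<open>A\<close> contains \<open>u\<close> only if
  \<open>A\<close> belongs to \<open>u\<close>, and it contains the principal ultrafilters at the
  points of \<open>A\<close>. Induction on the generation of open sets passes this to finite
  intersections and unions.\<close>

lemma limitin_beta_top_principal:
  assumes "u \<in> beta S"
  shows "limitin (beta_top S) (\<lambda>x. principal {x}) u u"
  unfolding limitin_def topspace_beta_top
proof (intro conjI allI impI assms)
  fix U assume "openin (beta_top S) U \<and> u \<in> U"
  then have "generate_topology_on {{u \<in> beta S. \<forall>\<^sub>F x in u. x \<in> A} | A. A \<subseteq> S} U" "u \<in> U"
    by (auto simp: beta_top_def openin_topology_generated_by_iff)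
  then show "\<forall>\<^sub>F x in u. principal {x} \<in> U"
  proof (induction rule: generate_topology_on.induct)
    case (Basis U)
    then obtain A where A: "A \<subseteq> S" "U = {u \<in> beta S. \<forall>\<^sub>F x in u. x \<in> A}" by blast
    then have "\<forall>\<^sub>F x in u. x \<in> A" using Basis by blast
    then show ?case
      by (rule eventually_mono) (use A in \<open>auto simp: eventually_principal intro: principal_in_beta\<close>)
  next
    case (UN K)
    then obtain V where "V \<in> K" "\<forall>\<^sub>F x in u. principal {x} \<in> V" by blast
    then show ?case by (auto elim: eventually_mono)
  qed (auto simp: eventually_conj_iff)
qed

section \<open>Continuous extensions as limits along ultrafilters\<close>

lemma continuous_map_limitin_beta:
  assumes "continuous_map (beta_top S) T G" "u \<in> beta S"
    and "\<And>x. x \<in> S \<Longrightarrow> G (principal {x}) = h x"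
  shows "limitin T h (G u) u"
proof -
  have "limitin T (G \<circ> (\<lambda>x. principal {x})) (G u) u"
    by (rule continuous_map_limit[OF assms(1) limitin_beta_top_principal[OF assms(2)]])
  then show ?thesis
    by (rule limitin_transform_eventually[rotated])
      (use beta_eventually_mem[OF assms(2)] assms(3) in \<open>auto elim: eventually_mono\<close>)
qed

text \<open>Both values are limits of one and the same function along the proper filter
  \<open>u\<close>. This serves as the density of the principal ultrafilters.\<close>

lemma continuous_map_beta_top_unique:
  assumes "Hausdorff_space T"
    and "continuous_map (beta_top S) T G" "continuous_map (beta_top S) T G'"
    and "\<And>x. x \<in> S \<Longrightarrow> G (principal {x}) = G' (principal {x})" "u \<in> beta S"
  shows "G u = G' u"
proof (rule limitin_Hausdorff_unique)
  show "limitin T (\<lambda>x. G' (principal {x})) (G u) u"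
    by (rule continuous_map_limitin_beta[OF assms(2,5) assms(4)])
  show "limitin T (\<lambda>x. G' (principal {x})) (G' u) u"
    by (rule continuous_map_limitin_beta[OF assms(3,5) refl])
  show "\<not> trivial_limit u"
    using beta_ultrafilter[OF assms(5)] by (simp add: ultrafilter_def)
qed (rule assms)

text \<open>Evaluates the definite description: it is enough to exhibit one continuous
  \<open>G\<close> with the right values at the principal ultrafilters.\<close>

lemma continuous_extension_eq:
  assumes "Hausdorff_space T" "continuous_map (beta_top S) T G"
    and "\<And>x. x \<in> S \<Longrightarrow> G (principal {x}) = h x" "u \<in> beta S"
  shows "continuous_extension S T h u = G u"
proof -
  \<comment> \<open>The definition demands extensionality, so \<open>G\<close> is reset to
    \<open>undefined\<close> off \<open>beta S\<close>.\<close>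
  have "continuous_extension S T h = restrict G (beta S)"
    unfolding continuous_extension_def
  proof (rule the_equality)
    have "continuous_map (beta_top S) T (restrict G (beta S))"
      by (rule continuous_map_eq[OF assms(2)]) simp
    then show "restrict G (beta S) \<in> extensional (beta S) \<and>
      continuous_map (beta_top S) T (restrict G (beta S)) \<and>
      (\<forall>x\<in>S. restrict G (beta S) (principal {x}) = h x)"
      by (simp add: assms(3) principal_in_beta)
  next
    fix g assume g: "g \<in> extensional (beta S) \<and> continuous_map (beta_top S) T g \<and>
      (\<forall>x\<in>S. g (principal {x}) = h x)"
    show "g = restrict G (beta S)"
    proof (rule extensionalityI[of _ "beta S"])
      fix v assume v: "v \<in> beta S"
      have "g v = G v"
        by (rule continuous_map_beta_top_unique[OF assms(1) _ assms(2) _ v])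
          (use g assms(3) in simp_all)
      with v show "g v = restrict G (beta S) v" by simp
    qed (use g in simp_all)
  qed
  then show ?thesis using assms(4) by simp
qed

text \<open>Convergence of the image filter is convergence of \<open>h\<close> along
  \<open>u\<close>. Combined with \<open>continuous_extension_eq\<close>, this identifies the limit
  of the image with the value of the extension.\<close>

lemma is_limit_filtermap_beta:
  assumes "Hausdorff_space T" "continuous_map (beta_top S) T G"
    and "\<And>x. x \<in> S \<Longrightarrow> G (principal {x}) = h x" "u \<in> beta S"
  shows "is_limit T (filtermap h u) (G u)"
proof -
  have eq: "limitin T (\<lambda>x. x) l (filtermap h u) \<longleftrightarrow> limitin T h l u" for l
    by (simp add: limitin_def eventually_filtermap)
  have "limitin T h (G u) u"
    by (rule continuous_map_limitin_beta[OF assms(2,4,3)])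
  moreover have "u \<noteq> bot"
    using beta_ultrafilter[OF assms(4)] by (simp add: ultrafilter_def)
  ultimately show ?thesis
    unfolding is_limit_def eq
    by (auto intro: limitin_Hausdorff_unique[OF _ _ _ assms(1)])
qed

lemma the_limit_eq: "is_limit T D l \<Longrightarrow> the_limit T D = l"
  unfolding the_limit_def is_limit_def by (rule the_equality) blast+

text \<open>Used for \<open>RC_top\<close>, \<open>clopens_top\<close>, \<open>Pow_top\<close> and
  \<open>RegCl_top\<close>: for each of them the Hausdorff property becomes injectivity of the map
  that defines the topology.\<close>

lemma Hausdorff_space_pullback_topology:
  assumes "Hausdorff_space T" "inj_on f A"
  shows "Hausdorff_space (pullback_topology A f T)"
  unfolding Hausdorff_space_def topspace_pullback_topology
proof (intro allI impI)
  fix x y assume xy: "x \<in> f -` topspace T \<inter> A \<and> y \<in> f -` topspace T \<inter> A \<and> x \<noteq> y"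
  then have "f x \<noteq> f y" using assms(2) by (auto dest: inj_onD)
  then obtain U V where UV: "openin T U" "openin T V" "f x \<in> U" "f y \<in> V" "disjnt U V"
    using assms(1) xy unfolding Hausdorff_space_def by blast
  then show "\<exists>U V. openin (pullback_topology A f T) U \<and> openin (pullback_topology A f T) V \<and>
      x \<in> U \<and> y \<in> V \<and> disjnt U V"
    using xy unfolding openin_pullback_topology
    by (intro exI[of _ "f -` U \<inter> A"] exI[of _ "f -` V \<inter> A"]) (auto simp: disjnt_iff)
qed

section \<open>Operations\<close>

lemma iterated_True: "iterated n u (\<lambda>_. True)"
  by (induction n) auto

lemma iterated_mono:
  "iterated n u P \<Longrightarrow> (\<And>x. P x \<Longrightarrow> Q x) \<Longrightarrow> iterated n u Q"
proof (induction n arbitrary: P Q)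
  case (Suc n)
  from Suc.prems(1) show ?case
    unfolding iterated.simps
    by (rule Suc.IH) (auto elim!: eventually_mono intro: Suc.prems(2))
qed auto

lemma iterated_conj:
  "iterated n u (\<lambda>x. P x \<and> Q x) \<longleftrightarrow> iterated n u P \<and> iterated n u Q"
  by (induction n arbitrary: P Q) (auto simp: eventually_conj_iff)

lemma iterated_not:
  "(\<And>i. i < n \<Longrightarrow> ultrafilter (u i)) \<Longrightarrow> iterated n u (\<lambda>x. \<not> P x) \<longleftrightarrow> \<not> iterated n u P"
  by (induction n arbitrary: P) (auto simp: ultrafilter_not)

lemma iterated_tuples:
  "(\<And>i. i < n \<Longrightarrow> u i \<in> beta X) \<Longrightarrow> iterated n u (\<lambda>x. x \<in> tuples n X)"
proof (induction n)
  case (Suc n)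
  then have "iterated n u (\<lambda>x. x \<in> tuples n X)" by simp
  then show ?case
    unfolding iterated.simps
  proof (rule iterated_mono)
    fix x assume x: "x \<in> tuples n X"
    show "\<forall>\<^sub>F a in u n. x(n := a) \<in> tuples (Suc n) X"
    proof (rule eventually_mono[OF beta_eventually_mem])
      show "u n \<in> beta X" using Suc.prems by simp
      show "x(n := a) \<in> tuples (Suc n) X" if "a \<in> X" for a
        using x that by (auto simp: tuples_def PiE_iff extensional_def less_Suc_eq)
    qed
  qed
qed (simp add: tuples_def)

text \<open>A quantifier over a principal ultrafilter is evaluation at its point. The restriction
  appears because \<open>iterated\<close> builds its tuple from the function that is constantly
  \<open>undefined\<close>.\<close>

lemma iterated_principal:
  "(\<And>i. i < n \<Longrightarrow> u i = principal {x i}) \<Longrightarrow>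
     iterated n u P \<longleftrightarrow> P (restrict x {..<n})"
proof (induction n arbitrary: P)
  case (Suc n)
  have eq: "(restrict x {..<n})(n := x n) = restrict x {..<Suc n}"
    by (auto simp: restrict_def)
  have "iterated (Suc n) u P \<longleftrightarrow> (\<forall>\<^sub>F a in u n. P ((restrict x {..<n})(n := a)))"
    unfolding iterated.simps by (rule Suc.IH) (simp add: Suc.prems)
  also have "\<dots> \<longleftrightarrow> P ((restrict x {..<n})(n := x n))"
    unfolding Suc.prems[OF lessI] eventually_principal by simp
  finally show ?case unfolding eq .
qed (simp add: restrict_def)

lemma iterated_principal_tuple:
  "x \<in> tuples n X \<Longrightarrow> iterated n (principal_tuple n x) P \<longleftrightarrow> P x"
  using iterated_principal[of n "principal_tuple n x" x P]
  by (simp add: principal_tuple_def tuples_def)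

text \<open>The source of right continuity: quantifiers before position \<open>i\<close> are
  evaluated at \<open>x\<close>, those after it are absorbed into the predicate, and one quantifier
  over \<open>v\<close> remains. It matters that \<open>B\<close> is chosen before
  \<open>v\<close>.\<close>

lemma iterated_single_quantifier:
  assumes "\<And>j. j < i \<Longrightarrow> u j = principal {x j}" "i < n"
  shows "\<exists>B. \<forall>v. iterated n (u(i := v)) P \<longleftrightarrow> eventually B v"
  using assms(2)
proof (induction n arbitrary: P)
  case (Suc n)
  show ?case
  proof (cases "i = n")
    case True
    have "iterated (Suc n) (u(i := v)) P \<longleftrightarrow>
        (\<forall>\<^sub>F a in v. P ((restrict x {..<n})(n := a)))" for v
      using assms(1) True by (simp add: iterated_principal)
    then show ?thesis by blast
  next
    case False
    then show ?thesis
      using Suc.IH[of "\<lambda>x. \<forall>\<^sub>F a in u n. P (x(n := a))"] Suc.prems by simp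
  qed
qed simp

(* The right continuous extension of h on tuples of points; tilde is the case in which
   every value of h is principal. *)
definition rc_extension ::
  "nat \<Rightarrow> 'a set \<Rightarrow> ((nat \<Rightarrow> 'a) \<Rightarrow> 'a filter) \<Rightarrow> (nat \<Rightarrow> 'a filter) \<Rightarrow> 'a filter" where
  "rc_extension n X h =
     (\<lambda>u\<in>tuples n (beta X). Abs_filter (\<lambda>P. iterated n u (\<lambda>x. eventually P (h x))))"

text \<open>\<open>Abs_filter\<close> is meaningful here because iterated quantifiers are monotone
  and commute with conjunction.\<close>

lemma eventually_rc_extension:
  assumes "u \<in> tuples n (beta X)"
  shows "eventually P (rc_extension n X h u) \<longleftrightarrow> iterated n u (\<lambda>x. eventually P (h x))"
proof -
  have "is_filter (\<lambda>P. iterated n u (\<lambda>x. eventually P (h x)))"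
    by standard (auto simp: iterated_True eventually_conj_iff iterated_conj
        elim!: iterated_mono eventually_mono)
  then show ?thesis using assms by (simp add: rc_extension_def eventually_Abs_filter)
qed

lemma tuples_beta_nth: "u \<in> tuples n S \<Longrightarrow> i < n \<Longrightarrow> u i \<in> S"
  by (auto simp: tuples_def)

text \<open>Negation passes through every quantifier in the prefix and then through the ultrafilter
  \<open>h x\<close>.\<close>

lemma rc_extension_in_beta:
  assumes u: "u \<in> tuples n (beta X)" and h: "\<And>x. x \<in> tuples n X \<Longrightarrow> h x \<in> beta X"
  shows "rc_extension n X h u \<in> beta X"
proof -
  have it: "iterated n u (\<lambda>x. x \<in> tuples n X)"
    by (rule iterated_tuples) (rule tuples_beta_nth[OF u])
  have not: "iterated n u (\<lambda>x. \<not> P x) \<longleftrightarrow> \<not> iterated n u P" for P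
    by (rule iterated_not) (rule beta_ultrafilter[OF tuples_beta_nth[OF u]])
  have "eventually P (rc_extension n X h u) \<or> eventually (\<lambda>x. \<not> P x) (rc_extension n X h u)" for P
  proof -
    have "iterated n u (\<lambda>x. eventually (\<lambda>y. \<not> P y) (h x))"
      if "iterated n u (\<lambda>x. \<not> eventually P (h x))"
    proof -
      \<comment> \<open>Nothing is known about \<open>h\<close> off \<open>tuples n X\<close>;
        adding this membership under the quantifiers makes \<open>h x\<close> an
        ultrafilter.\<close>
      have "iterated n u (\<lambda>x. \<not> eventually P (h x) \<and> x \<in> tuples n X)"
        using that by (simp add: iterated_conj it)
      then show ?thesis
        by (rule iterated_mono) (simp add: ultrafilter_not[OF beta_ultrafilter[OF h]])
    qed
    then show ?thesis
      unfolding eventually_rc_extension[OF u] using not by blast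
  qed
  moreover have "\<not> eventually (\<lambda>_. False) (rc_extension n X h u)"
  proof
    assume "eventually (\<lambda>_. False) (rc_extension n X h u)"
    then have "iterated n u (\<lambda>x. eventually (\<lambda>_. False) (h x) \<and> x \<in> tuples n X)"
      by (simp add: eventually_rc_extension[OF u] iterated_conj it)
    \<comment> \<open>Falsity is written as a negation so that \<open>not\<close> applies to
      it.\<close>
    then have "iterated n u (\<lambda>x. \<not> True)"
      by (rule iterated_mono)
        (use h beta_ultrafilter in \<open>auto simp: ultrafilter_def trivial_limit_def\<close>)
    then show False using not[of "\<lambda>_. True"] by (simp add: iterated_True)
  qed
  moreover have "eventually (\<lambda>x. x \<in> X) (rc_extension n X h u)"
    unfolding eventually_rc_extension[OF u]
    by (rule iterated_mono[OF it]) (rule beta_eventually_mem[OF h])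
  ultimately show ?thesis
    by (simp add: beta_def ultrafilter_def trivial_limit_def le_principal)
qed

lemma tuples_fun_upd:
  "u \<in> tuples n S \<Longrightarrow> i < n \<Longrightarrow> v \<in> S \<Longrightarrow> u(i := v) \<in> tuples n S"
  by (auto simp: tuples_def PiE_iff extensional_def)

text \<open>When the coordinates before \<open>i\<close> are principal, membership of
  \<open>A\<close> in the value is a single quantifier over coordinate \<open>i\<close>, and so
  defines an open set.\<close>

lemma rc_extension_in_RC:
  assumes h: "\<And>x. x \<in> tuples n X \<Longrightarrow> h x \<in> beta X"
  shows "rc_extension n X h \<in> RC n X"
proof -
  have "continuous_map (beta_top X) (beta_top X) (\<lambda>v. rc_extension n X h (u(i := v)))"
    if i: "i < n" and u: "u \<in> tuples n (beta X)" and pr: "\<forall>j<i. \<exists>x\<in>X. u j = principal {x}"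
    for i u
  proof (rule continuous_map_into_beta_top; simp)
    fix v assume "v \<in> beta X"
    then show "rc_extension n X h (u(i := v)) \<in> beta X"
      using u i by (intro rc_extension_in_beta h tuples_fun_upd)
  next
    fix A
    obtain x where x: "\<And>j. j < i \<Longrightarrow> u j = principal {x j}" using pr by metis
    obtain B where B: "\<And>v. iterated n (u(i := v)) (\<lambda>x. \<forall>\<^sub>F y in h x. y \<in> A) \<longleftrightarrow> eventually B v"
      using iterated_single_quantifier[of i u x, OF x i] by blast
    have "{t \<in> beta X. \<forall>\<^sub>F x in rc_extension n X h (u(i := t)). x \<in> A} = {t \<in> beta X. eventually B t}"
      using u i by (auto simp: eventually_rc_extension tuples_fun_upd B)
    then show "openin (beta_top X) {t \<in> beta X. \<forall>\<^sub>F x in rc_extension n X h (u(i := t)). x \<in> A}"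
      by (simp add: openin_beta_top)
  qed
  moreover have "rc_extension n X h \<in> tuples n (beta X) \<rightarrow>\<^sub>E beta X"
    using rc_extension_in_beta[OF _ h] by (auto simp: rc_extension_def)
  ultimately show ?thesis by (simp add: RC_def)
qed

lemma principal_tuple_in_tuples: "x \<in> tuples n X \<Longrightarrow> principal_tuple n x \<in> tuples n (beta X)"
  by (auto simp: tuples_def principal_tuple_def intro!: principal_in_beta)

lemma rc_extension_principal_tuple:
  "x \<in> tuples n X \<Longrightarrow> rc_extension n X h (principal_tuple n x) = h x"
  by (simp add: filter_eq_iff eventually_rc_extension[OF principal_tuple_in_tuples]
      iterated_principal_tuple)

lemma tilde_eq_rc_extension: "tilde n X f = rc_extension n X (\<lambda>x. principal {f x})"
  by (simp add: tilde_def rc_extension_def eventually_principal)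

lemma RC_eqI:
  assumes g: "g \<in> RC n X" "g' \<in> RC n X"
    and eq: "\<And>x. x \<in> tuples n X \<Longrightarrow> g (principal_tuple n x) = g' (principal_tuple n x)"
  shows "g = g'"
proof -
  (* Principal coordinates are released one at a time, from the last one backwards. *)
  have *: "\<forall>u\<in>tuples n (beta X). (\<forall>j<k. \<exists>x\<in>X. u j = principal {x}) \<longrightarrow> g u = g' u"
    if "k \<le> n" for k
    using that
  proof (induction k rule: inc_induct)
    case base
    show ?case
    proof (intro ballI impI)
      fix u assume u: "u \<in> tuples n (beta X)" "\<forall>j<n. \<exists>x\<in>X. u j = principal {x}"
      then obtain x where x: "\<And>j. j < n \<Longrightarrow> x j \<in> X \<and> u j = principal {x j}" by metis
      have "restrict x {..<n} \<in> tuples n X" using x by (auto simp: tuples_def)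
      moreover have "u = principal_tuple n (restrict x {..<n})"
        using u x by (auto simp: tuples_def principal_tuple_def PiE_iff extensional_def fun_eq_iff)
      ultimately show "g u = g' u" using eq by simp
    qed
  next
    case (step k)
    show ?case
    proof (intro ballI impI)
      fix u assume u: "u \<in> tuples n (beta X)" "\<forall>j<k. \<exists>x\<in>X. u j = principal {x}"
      \<comment> \<open>The update changes nothing but displays \<open>u\<close> as a function of
        coordinate \<open>k\<close>. All earlier coordinates are principal, so right continuity
        applies, and at principal values the induction hypothesis for \<open>Suc k\<close> gives
        agreement.\<close>
      have "g (u(k := u k)) = g' (u(k := u k))"
      proof (rule continuous_map_beta_top_unique[OF Hausdorff_space_beta_top,
            where S = X and G = "\<lambda>v. g (u(k := v))" and G' = "\<lambda>v. g' (u(k := v))"])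
        show "continuous_map (beta_top X) (beta_top X) (\<lambda>v. g (u(k := v)))"
          "continuous_map (beta_top X) (beta_top X) (\<lambda>v. g' (u(k := v)))"
          using g u step.hyps by (auto simp: RC_def)
        show "u k \<in> beta X" using u(1) step.hyps(2) by (rule tuples_beta_nth)
        show "g (u(k := principal {x})) = g' (u(k := principal {x}))" if "x \<in> X" for x
          by (rule step.IH[rule_format, OF tuples_fun_upd[OF u(1) step.hyps(2) principal_in_beta[OF that]]])
            (use u(2) that in \<open>auto simp: less_Suc_eq\<close>)
      qed
      then show "g u = g' u" by simp
    qed
  qed
  show ?thesis
  proof (rule extensionalityI)
    show "g \<in> extensional (tuples n (beta X))" "g' \<in> extensional (tuples n (beta X))"
      using g by (auto simp: RC_def PiE_def)
    show "g u = g' u" if "u \<in> tuples n (beta X)" for u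
      using *[of 0] that by simp
  qed
qed

text \<open>Evaluation at principal tuples is injective on \<open>RC n X\<close> by
  \<open>RC_eqI\<close>.\<close>

lemma Hausdorff_space_RC_top: "Hausdorff_space (RC_top n X)"
  unfolding RC_top_def
proof (rule Hausdorff_space_pullback_topology)
  show "Hausdorff_space (product_topology (\<lambda>_. beta_top X) (tuples n X))"
    by (simp add: Hausdorff_space_product_topology Hausdorff_space_beta_top)
  show "inj_on (\<lambda>g. \<lambda>x\<in>tuples n X. g (principal_tuple n x)) (RC n X)"
  proof (rule inj_onI)
    fix g g' assume g: "g \<in> RC n X" "g' \<in> RC n X"
      and "(\<lambda>x\<in>tuples n X. g (principal_tuple n x)) = (\<lambda>x\<in>tuples n X. g' (principal_tuple n x))"
    then show "g = g'"
      by (intro RC_eqI[OF g]) (metis restrict_apply')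
  qed
qed

text \<open>The image of \<open>\<ff>\<close> under evaluation at \<open>x\<close> is the limit
  along \<open>\<ff>\<close> of the principal ultrafilters at \<open>f x\<close>.\<close>

definition op_extension ::
  "nat \<Rightarrow> 'a set \<Rightarrow> ((nat \<Rightarrow> 'a) \<Rightarrow> 'a) filter \<Rightarrow> (nat \<Rightarrow> 'a filter) \<Rightarrow> 'a filter" where
  "op_extension n X \<ff> = rc_extension n X (\<lambda>x. filtermap (\<lambda>f. f x) \<ff>)"

lemma eval_in_beta:
  "\<ff> \<in> beta (operations n X) \<Longrightarrow> x \<in> tuples n X \<Longrightarrow> filtermap (\<lambda>f. f x) \<ff> \<in> beta X"
  by (erule filtermap_in_beta) (auto simp: operations_def)

lemma op_extension_principal: "op_extension n X (principal {f}) = tilde n X f"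
  by (simp add: op_extension_def tilde_eq_rc_extension)

text \<open>\<open>RC_top\<close> tests only principal tuples, where \<open>op_extension\<close>
  reduces to the image under evaluation; \<open>A\<close> belongs to that image iff
  \<open>\<ff>\<close> contains the set of \<open>f\<close> with \<open>f x \<in> A\<close>, an open
  condition on \<open>\<ff>\<close>.\<close>

lemma continuous_map_op_extension:
  "continuous_map (beta_top (operations n X)) (RC_top n X) (op_extension n X)"
  unfolding RC_top_def
proof (rule continuous_map_pullback')
  show "topspace (beta_top (operations n X)) \<subseteq> op_extension n X -` RC n X"
    by (auto simp: op_extension_def intro!: rc_extension_in_RC eval_in_beta)
  have "continuous_map (beta_top (operations n X)) (product_topology (\<lambda>_. beta_top X) (tuples n X))
      (\<lambda>\<ff>. \<lambda>x\<in>tuples n X. filtermap (\<lambda>f. f x) \<ff>)"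
    unfolding continuous_map_componentwise
  proof (intro conjI ballI)
    fix x assume x: "x \<in> tuples n X"
    show "continuous_map (beta_top (operations n X)) (beta_top X)
        (\<lambda>\<ff>. (\<lambda>x\<in>tuples n X. filtermap (\<lambda>f. f x) \<ff>) x)"
      using x by (intro continuous_map_into_beta_top)
        (auto simp: eval_in_beta eventually_filtermap openin_beta_top)
  qed auto
  then show "continuous_map (beta_top (operations n X)) (product_topology (\<lambda>_. beta_top X) (tuples n X))
      ((\<lambda>g. \<lambda>x\<in>tuples n X. g (principal_tuple n x)) \<circ> op_extension n X)"
    by (rule continuous_map_eq)
      (auto simp: op_extension_def rc_extension_principal_tuple)
qed

lemma is_limit_I_fun:
  assumes "\<ff> \<in> beta (operations n X)"
  shows "is_limit (RC_top n X) (I_fun n X \<ff>) (E_fun n X \<ff>)"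
proof -
  \<comment> \<open>The same data determine the value of the extension and the limit of the
    image.\<close>
  note ext = Hausdorff_space_RC_top continuous_map_op_extension op_extension_principal assms
  have "E_fun n X \<ff> = op_extension n X \<ff>"
    unfolding E_fun_def by (rule continuous_extension_eq[OF ext])
  then show ?thesis
    unfolding I_fun_def by (simp add: is_limit_filtermap_beta[OF ext])
qed

section \<open>Predicates\<close>

text \<open>For an ultrafilter \<open>r\<close> on \<open>Pow S\<close> this is the limit of the
  sets \<open>Q\<close> along \<open>r\<close> in the power of the two-point space.\<close>

definition almost_all :: "'a set \<Rightarrow> 'a set filter \<Rightarrow> 'a set" where
  "almost_all S r = {x \<in> S. \<forall>\<^sub>F Q in r. x \<in> Q}"

lemma almost_all_in_Pow: "almost_all S r \<in> Pow S"
  by (auto simp: almost_all_def)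

lemma almost_all_principal: "Q \<in> Pow S \<Longrightarrow> almost_all S (principal {Q}) = Q"
  by (auto simp: almost_all_def eventually_principal)

text \<open>Each coordinate is a single quantifier over \<open>r\<close>. This serves both the
  clopen sets and the power set, whose topologies are pulled back from the same product.\<close>

lemma continuous_map_almost_all:
  "continuous_map (beta_top R) (product_topology (\<lambda>_. discrete_topology UNIV) S)
     (\<lambda>r. \<lambda>x\<in>S. x \<in> almost_all S r)"
  unfolding continuous_map_componentwise
proof (intro conjI ballI)
  fix x assume "x \<in> S"
  then have "(\<lambda>r. (\<lambda>x\<in>S. x \<in> almost_all S r) x) = (\<lambda>r. \<forall>\<^sub>F Q in r. x \<in> Q)"
    by (simp add: almost_all_def)
  then show "continuous_map (beta_top R) (discrete_topology UNIV) (\<lambda>r. (\<lambda>x\<in>S. x \<in> almost_all S r) x)"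
    by (simp only: continuous_map_eventually)
qed auto

lemma Hausdorff_space_clopens_top: "Hausdorff_space (clopens_top S)"
  unfolding clopens_top_def
proof (rule Hausdorff_space_pullback_topology)
  show "Hausdorff_space (product_topology (\<lambda>_. discrete_topology (UNIV :: bool set)) S)"
    by (simp add: Hausdorff_space_product_topology Hausdorff_space_discrete_topology)
  \<comment> \<open>A clopen set is determined by its principal members: the principal ultrafilters
    converge to \<open>u\<close> along \<open>u\<close>, and both \<open>C\<close> and its
    complement are open.\<close>
  have mem: "u \<in> C \<longleftrightarrow> (\<forall>\<^sub>F x in u. principal {x} \<in> C)" if C: "C \<in> clopens S" and u: "u \<in> beta S" for C u
  proof -
    have ev: "\<forall>\<^sub>F x in u. principal {x} \<in> U" if "openin (beta_top S) U" "u \<in> U" for U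
      using limitin_beta_top_principal[OF u] that by (simp add: limitin_def)
    have op: "openin (beta_top S) C" "openin (beta_top S) (beta S - C)"
      using C by (auto simp: clopens_def closedin_def)
    then show ?thesis
      using ev[OF op(1)] ev[OF op(2)] u
        ultrafilter_not[OF beta_ultrafilter[OF u], of "\<lambda>x. principal {x} \<in> C"]
      by (cases "u \<in> C") (simp_all add: eventually_conj_iff)
  qed
  show "inj_on (\<lambda>C. \<lambda>x\<in>S. principal {x} \<in> C) (clopens S)"
  proof (rule inj_onI)
    fix C D assume C: "C \<in> clopens S" "D \<in> clopens S"
      and eq: "(\<lambda>x\<in>S. principal {x} \<in> C) = (\<lambda>x\<in>S. principal {x} \<in> D)"
    have eq': "principal {x} \<in> C \<longleftrightarrow> principal {x} \<in> D" if "x \<in> S" for x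
      using fun_cong[OF eq, of x] that by simp
    have "(\<forall>\<^sub>F x in u. principal {x} \<in> C) \<longleftrightarrow> (\<forall>\<^sub>F x in u. principal {x} \<in> D)" if "u \<in> beta S" for u
      by (rule eventually_cong[OF beta_eventually_mem[OF that]]) (simp add: eq')
    moreover have "C \<subseteq> beta S" "D \<subseteq> beta S"
      using C by (simp_all add: clopens_def openin_subset[where U = "beta_top S", simplified])
    ultimately have "u \<in> C \<longleftrightarrow> u \<in> D" for u
      using mem[OF C(1), of u] mem[OF C(2), of u] by (cases "u \<in> beta S") auto
    then show "C = D" by blast
  qed
qed

text \<open>At the principal ultrafilter of \<open>x\<close> the clopen set of
  \<open>almost_all\<close> reads off membership of \<open>x\<close>, so continuity is that of
  \<open>almost_all\<close>.\<close>

lemma e1_eq: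
  assumes "r \<in> beta (Pow (tuples n X))"
  shows "e1 n X r = {q \<in> beta (tuples n X). \<forall>\<^sub>F x in q. x \<in> almost_all (tuples n X) r}"
  unfolding e1_def
proof (rule continuous_extension_eq[OF Hausdorff_space_clopens_top _ _ assms])
  let ?G = "\<lambda>r. {q \<in> beta (tuples n X). \<forall>\<^sub>F x in q. x \<in> almost_all (tuples n X) r}"
  show "continuous_map (beta_top (Pow (tuples n X))) (clopens_top (tuples n X)) ?G"
    unfolding clopens_top_def
  proof (rule continuous_map_pullback')
    show "topspace (beta_top (Pow (tuples n X))) \<subseteq> ?G -` clopens (tuples n X)"
      by (auto simp: clopens_def openin_beta_top closedin_beta_top)
    show "continuous_map (beta_top (Pow (tuples n X)))
        (product_topology (\<lambda>_. discrete_topology (UNIV :: bool set)) (tuples n X))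
        ((\<lambda>C. \<lambda>x\<in>tuples n X. principal {x} \<in> C) \<circ> ?G)"
      by (rule continuous_map_eq[OF continuous_map_almost_all])
        (auto simp: principal_in_beta eventually_principal fun_eq_iff)
  qed
qed (simp add: almost_all_principal)

text \<open>Membership in \<open>star\<close> says that \<open>Q\<close> meets every box of members
  of the \<open>u i\<close>. Hence \<open>Q\<close> and the cylinders over these members generate a
  proper filter, and any ultrafilter below it projects onto \<open>u\<close>.\<close>

lemma star_imp_projection:
  assumes "Q \<subseteq> tuples n X" "u \<in> star n X Q"
  obtains q where "q \<in> beta (tuples n X)" "\<forall>\<^sub>F x in q. x \<in> Q"
    "(\<lambda>j\<in>{..<n}. filtermap (\<lambda>x. x j) q) = u"
proof -
  have u: "u \<in> tuples n (beta X)" using assms(2) by (simp add: star_def)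
  define F where "F = inf (INF j\<in>{..<n}. filtercomap (\<lambda>x. x j) (u j)) (principal Q)"
  have "F \<noteq> bot"
  proof
    assume "F = bot"
    then have "eventually (\<lambda>_. False) F" by simp
    then have "eventually (\<lambda>x. x \<notin> Q) (INF j\<in>{..<n}. filtercomap (\<lambda>x. x j) (u j))"
      unfolding F_def by (simp add: eventually_inf_principal)
    then obtain P where P: "\<And>j. j < n \<Longrightarrow> eventually (P j) (filtercomap (\<lambda>x. x j) (u j))"
      and PQ: "\<And>x. (\<forall>j<n. P j x) \<Longrightarrow> x \<notin> Q"
      unfolding eventually_INF_finite[OF finite_lessThan] by blast
    then have "\<forall>j. \<exists>P'. j < n \<longrightarrow> eventually P' (u j) \<and> (\<forall>x. P' (x j) \<longrightarrow> P j x)"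
      unfolding eventually_filtercomap by blast
    then obtain P' where P': "\<And>j. j < n \<Longrightarrow> eventually (P' j) (u j)"
      "\<And>j x. j < n \<Longrightarrow> P' j (x j) \<Longrightarrow> P j x"
      by metis
    \<comment> \<open>The sides are cut down to \<open>X\<close> because \<open>star\<close> ranges
      over boxes inside \<open>X\<close>.\<close>
    have "Q \<inter> Pi\<^sub>E {..<n} (\<lambda>j. {a \<in> X. P' j a}) \<noteq> {}"
      using assms(2) P'(1) tuples_beta_nth[OF u]
      by (auto simp: star_def eventually_beta_restrict)
    then obtain x where "x \<in> Q" "\<And>j. j < n \<Longrightarrow> P' j (x j)" by auto
    then show False using P'(2) PQ by blast
  qed
  then obtain q where q: "ultrafilter q" "q \<le> F" by (rule ultrafilter_exists)
  have "eventually (\<lambda>x. x \<in> Q) q"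
    using q(2) unfolding F_def le_inf_iff le_principal by blast
  moreover from this have "q \<in> beta (tuples n X)"
    using q(1) assms(1) by (auto simp: beta_def le_principal elim: eventually_mono)
  \<comment> \<open>The projection is a proper filter below the ultrafilter \<open>u j\<close>, so
    minimality gives equality.\<close>
  moreover have "filtermap (\<lambda>x. x j) q = u j" if "j < n" for j
  proof (rule ultrafilter_eqI)
    show "ultrafilter (u j)" using tuples_beta_nth[OF u that] by (rule beta_ultrafilter)
    show "filtermap (\<lambda>x. x j) q \<noteq> bot" using q(1) by (simp add: ultrafilter_def filtermap_bot_iff)
    have "q \<le> filtercomap (\<lambda>x. x j) (u j)"
      using q(2) that unfolding F_def le_inf_iff le_INF_iff by blast
    then show "filtermap (\<lambda>x. x j) q \<le> u j"
      by (simp add: filtermap_le_iff_le_filtercomap)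
  qed
  then have "(\<lambda>j\<in>{..<n}. filtermap (\<lambda>x. x j) q) = u"
    using u by (auto simp: tuples_def PiE_iff extensional_def fun_eq_iff)
  ultimately show ?thesis using that by blast
qed

text \<open>There are finitely many coordinates, so their conditions and membership in
  \<open>Q\<close> hold together on a member of \<open>q\<close>, which is nonempty.\<close>

lemma projection_in_star:
  assumes q: "q \<in> beta (tuples n X)" "\<forall>\<^sub>F x in q. x \<in> Q"
  shows "(\<lambda>j\<in>{..<n}. filtermap (\<lambda>x. x j) q) \<in> star n X Q"
proof -
  have "filtermap (\<lambda>x. x j) q \<in> beta X" if "j < n" for j
    using q(1) by (rule filtermap_in_beta) (rule tuples_beta_nth[OF _ that])
  moreover have "Q \<inter> Pi\<^sub>E {..<n} A \<noteq> {}"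
    if "\<And>i. i < n \<Longrightarrow> \<forall>\<^sub>F x in q. x i \<in> A i" for A
  proof -
    have "\<forall>\<^sub>F x in q. \<forall>i\<in>{..<n}. x i \<in> A i"
      by (rule eventually_ball_finite) (auto intro: that)
    then have "\<forall>\<^sub>F x in q. x \<in> tuples n X \<and> x \<in> Q \<and> (\<forall>i\<in>{..<n}. x i \<in> A i)"
      using q(2) beta_eventually_mem[OF q(1)] by (simp add: eventually_conj_iff)
    then obtain x where "x \<in> tuples n X" "x \<in> Q" "\<forall>i\<in>{..<n}. x i \<in> A i"
      using beta_ultrafilter[OF q(1)] eventually_happens' unfolding ultrafilter_def by blast
    then have "x \<in> Q \<inter> Pi\<^sub>E {..<n} A" by (auto simp: tuples_def PiE_iff)
    then show ?thesis by blast
  qed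
  ultimately show ?thesis
    by (auto simp: star_def tuples_def eventually_filtermap)
qed

lemma E_pred_eq:
  assumes "r \<in> beta (Pow (tuples n X))"
  shows "E_pred n X r = star n X (almost_all (tuples n X) r)"
proof
  show "E_pred n X r \<subseteq> star n X (almost_all (tuples n X) r)"
    unfolding E_pred_def e1_eq[OF assms] by (auto intro: projection_in_star)
next
  have sub: "almost_all (tuples n X) r \<subseteq> tuples n X" using almost_all_in_Pow[of "tuples n X" r] by simp
  show "star n X (almost_all (tuples n X) r) \<subseteq> E_pred n X r"
  proof
    fix u assume "u \<in> star n X (almost_all (tuples n X) r)"
    then obtain q where "q \<in> beta (tuples n X)" "\<forall>\<^sub>F x in q. x \<in> almost_all (tuples n X) r"
      "(\<lambda>j\<in>{..<n}. filtermap (\<lambda>x. x j) q) = u"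
      by (rule star_imp_projection[OF sub])
    then show "u \<in> E_pred n X r"
      unfolding E_pred_def e1_eq[OF assms] by blast
  qed
qed

section \<open>Injectivity of \<open>star\<close> and the topology of regular closed sets\<close>

lemma principal_tuple_in_star:
  assumes "x \<in> tuples n X"
  shows "principal_tuple n x \<in> star n X Q \<longleftrightarrow> x \<in> Q"
proof
  assume "x \<in> Q"
  show "principal_tuple n x \<in> star n X Q"
    unfolding star_def
  proof (intro CollectI conjI allI impI principal_tuple_in_tuples[OF assms])
    fix A assume "\<forall>i<n. A i \<subseteq> X \<and> (\<forall>\<^sub>F y in principal_tuple n x i. y \<in> A i)"
    then have "x \<in> Pi\<^sub>E {..<n} A"
      using assms by (simp add: principal_tuple_def eventually_principal tuples_def PiE_iff)
    with \<open>x \<in> Q\<close> show "Q \<inter> Pi\<^sub>E {..<n} A \<noteq> {}" by blast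
  qed
next
  assume "principal_tuple n x \<in> star n X Q"
  then have "(\<forall>i<n. A i \<subseteq> X \<and> (\<forall>\<^sub>F y in principal_tuple n x i. y \<in> A i)) \<longrightarrow>
      Q \<inter> Pi\<^sub>E {..<n} A \<noteq> {}" for A
    unfolding star_def by simp
  moreover have "\<forall>i<n. {x i} \<subseteq> X \<and> (\<forall>\<^sub>F y in principal_tuple n x i. y \<in> {x i})"
    using assms by (auto simp: principal_tuple_def eventually_principal tuples_def)
  \<comment> \<open>The box with singleton sides contains only \<open>x\<close>.\<close>
  ultimately have "Q \<inter> Pi\<^sub>E {..<n} (\<lambda>i. {x i}) \<noteq> {}"
    by (rule mp)
  then obtain y where "y \<in> Q" "y \<in> Pi\<^sub>E {..<n} (\<lambda>i. {x i})" by blast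
  moreover from this have "y = x"
    using assms by (intro PiE_ext[of y "{..<n}" "\<lambda>i. {x i}" x]) (auto simp: tuples_def PiE_iff)
  ultimately show "x \<in> Q" by simp
qed

text \<open>\<open>Q\<close> is recovered from its star as the trace on the principal
  tuples.\<close>

lemma inj_on_star: "inj_on (star n X) (Pow (tuples n X))"
proof (rule inj_onI)
  fix P Q assume sub: "P \<in> Pow (tuples n X)" "Q \<in> Pow (tuples n X)"
    and eq: "star n X P = star n X Q"
  have "x \<in> P \<longleftrightarrow> x \<in> Q" if "x \<in> tuples n X" for x
    using principal_tuple_in_star[OF that, of P] principal_tuple_in_star[OF that, of Q] eq by simp
  then show "P = Q" using sub by blast
qed

lemma Hausdorff_space_Pow_top: "Hausdorff_space (Pow_top S)"
  unfolding Pow_top_def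
proof (rule Hausdorff_space_pullback_topology)
  show "Hausdorff_space (product_topology (\<lambda>_. discrete_topology (UNIV :: bool set)) S)"
    by (simp add: Hausdorff_space_product_topology Hausdorff_space_discrete_topology)
  show "inj_on (\<lambda>Q. \<lambda>x\<in>S. x \<in> Q) (Pow S)"
  proof (rule inj_onI)
    fix P Q assume "P \<in> Pow S" "Q \<in> Pow S" and eq: "(\<lambda>x\<in>S. x \<in> P) = (\<lambda>x\<in>S. x \<in> Q)"
    moreover have "x \<in> P \<longleftrightarrow> x \<in> Q" if "x \<in> S" for x
      using fun_cong[OF eq, of x] that by simp
    ultimately show "P = Q" by blast
  qed
qed

lemma Hausdorff_space_RegCl_top: "Hausdorff_space (RegCl_top n X)"
  unfolding RegCl_top_def RegCl_def
  by (rule Hausdorff_space_pullback_topology[OF Hausdorff_space_Pow_top inj_on_inv_into]) simp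

text \<open>The topology of \<open>RegCl_top\<close> is transported along the inverse of
  \<open>star\<close>, which cancels and leaves the continuity of \<open>almost_all\<close> into the
  power set.\<close>

lemma continuous_map_star_almost_all:
  "continuous_map (beta_top (Pow (tuples n X))) (RegCl_top n X)
     (\<lambda>r. star n X (almost_all (tuples n X) r))"
  unfolding RegCl_top_def
proof (rule continuous_map_pullback')
  show "topspace (beta_top (Pow (tuples n X)))
      \<subseteq> (\<lambda>r. star n X (almost_all (tuples n X) r)) -` RegCl n X"
    unfolding RegCl_def by (intro subsetI vimageI2 imageI almost_all_in_Pow)
  have "continuous_map (beta_top (Pow (tuples n X))) (Pow_top (tuples n X)) (almost_all (tuples n X))"
    unfolding Pow_top_def
  proof (rule continuous_map_pullback')
    show "topspace (beta_top (Pow (tuples n X))) \<subseteq> almost_all (tuples n X) -` Pow (tuples n X)"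
      by (intro subsetI vimageI2 almost_all_in_Pow)
    show "continuous_map (beta_top (Pow (tuples n X)))
        (product_topology (\<lambda>_. discrete_topology (UNIV :: bool set)) (tuples n X))
        ((\<lambda>Q. \<lambda>x\<in>tuples n X. x \<in> Q) \<circ> almost_all (tuples n X))"
      unfolding comp_def by (rule continuous_map_almost_all)
  qed
  then show "continuous_map (beta_top (Pow (tuples n X))) (Pow_top (tuples n X))
      (inv_into (Pow (tuples n X)) (star n X) \<circ> (\<lambda>r. star n X (almost_all (tuples n X) r)))"
    by (rule continuous_map_eq) (simp only: comp_apply inv_into_f_f[OF inj_on_star almost_all_in_Pow])
qed

lemma is_limit_I_pred:
  assumes "r \<in> beta (Pow (tuples n X))"
  shows "is_limit (RegCl_top n X) (I_pred n X r) (E_pred n X r)"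
  unfolding I_pred_def E_pred_eq[OF assms]
  by (rule is_limit_filtermap_beta[OF Hausdorff_space_RegCl_top continuous_map_star_almost_all _ assms])
    (simp add: almost_all_principal)

theorem theorem43:
  fixes \<Sigma> :: "('f, 'p) signature"
    and X :: "'a set"
    and \<AA> :: "('a filter, 'f, ((nat \<Rightarrow> 'a) \<Rightarrow> 'a) filter, 'p, (nat \<Rightarrow> 'a) set filter) model"
  assumes "narrow_model \<Sigma> X \<AA>"
  shows "lim_model \<Sigma> X (I_model \<Sigma> X \<AA>) = E_model \<Sigma> X \<AA> \<and>
    (\<forall>F\<in>fun_syms \<Sigma>.
       is_limit (RC_top (fun_arity \<Sigma> F) X)
         (I_fun (fun_arity \<Sigma> F) X (fun_int \<AA> F))
         (E_fun (fun_arity \<Sigma> F) X (fun_int \<AA> F))) \<and>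
    (\<forall>R\<in>pred_syms \<Sigma>.
       is_limit (RegCl_top (pred_arity \<Sigma> R) X)
         (I_pred (pred_arity \<Sigma> R) X (pred_int \<AA> R))
         (E_pred (pred_arity \<Sigma> R) X (pred_int \<AA> R)))"
proof -
  have F: "is_limit (RC_top (fun_arity \<Sigma> F) X)
         (I_fun (fun_arity \<Sigma> F) X (fun_int \<AA> F))
         (E_fun (fun_arity \<Sigma> F) X (fun_int \<AA> F))" if "F \<in> fun_syms \<Sigma>" for F
    using assms that by (auto simp: narrow_model_def intro: is_limit_I_fun)
  have R: "is_limit (RegCl_top (pred_arity \<Sigma> R) X)
         (I_pred (pred_arity \<Sigma> R) X (pred_int \<AA> R))
         (E_pred (pred_arity \<Sigma> R) X (pred_int \<AA> R))" if "R \<in> pred_syms \<Sigma>" for R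
    using assms that by (auto simp: narrow_model_def intro: is_limit_I_pred)
  \<comment> \<open>All interpretations are restricted to the symbols of the signature, so the
    models agree once the limits do symbol by symbol.\<close>
  have "lim_model \<Sigma> X (I_model \<Sigma> X \<AA>) = E_model \<Sigma> X \<AA>"
    by (auto simp: lim_model_def I_model_def E_model_def the_limit_eq[OF F] the_limit_eq[OF R]
        intro!: restrict_ext)
  with F R show ?thesis by blast
qed

end
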